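(* Let $q$ be a prime power, $r\ge1$ an integer, and $\boldsymbol\alpha=(\alpha_1,\ldots,\alpha_r)\in\mathfrak p^r$, where $\mathfrak p=t^{-1}\mathbb F_q[[t^{-1}]]$. For every $n\ge0$, if $D=L_r(n)$, then $$\dim_{\mathbb F_q}\mathcal K^{(r)}_D(n)=1.$$
   Context: For $d\ge1$ let $V_d=\{Q\in\mathbb F_q[t]:\deg Q<d\}$ (including $0$), and $V_0=\{0\}$. Write $\alpha_i=\sum_{j\ge1}u^{(i)}_jt^{-j}$. For $n\ge0$ and $d\ge1$, $\mathcal K^{(r)}_d(n)\subseteq V_d$ is the $\mathbb F_q$-subspace of polynomials $Q=\theta_0+\cdots+\theta_{d-1}t^{d-1}$ whose coefficient vector $(\theta_0,\ldots,\theta_{d-1})^{\mathsf T}$ lies in the kernel of the $rn\times d$ matrix obtained by stacking, for $1\le i\le r$, the $n\times d$ Hankel blocks with $(a,b)$ entry $u^{(i)}_{a+b-1}$ (for $n=0$ the empty matrix with $d$ columns). Equivalently, it consists of the $Q\in V_d$ such that the coefficients of $t^{-1},\ldots,t^{-n}$ in every $Q\alpha_i$ vanish. Put $\mathcal K^{(r)}_0(n)=\{0\}$, and $$L_r(n)=\min\{d\ge1:\mathcal K^{(r)}_d(n)\ne0\}.$$ *)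

theory Defs
  imports
    "HOL-Computational_Algebra.Formal_Power_Series"
    "Jordan_Normal_Form.Matrix_Kernel"
begin

text \<open>
  Elements of \<open>F_q[[t^{-1}]]\<close> are represented as formal power series in the variable
  \<open>t^{-1}\<close>: for \<open>\<alpha> = (\<Sum>j. u j * t^{-j})\<close> the coefficient \<open>u j\<close> is \<open>fps_nth \<alpha> j\<close>.
\<close>

definition frak_p :: "'a::field fps set" where
  "frak_p = {f. fps_nth f 0 = 0}"

definition polys_below :: "nat \<Rightarrow> 'a::field poly set" where
  "polys_below d = {Q. Q = 0 \<or> degree Q < d}"

text \<open>
  Matrix indices start at 0 here, so the usual entry \<open>u (a + b - 1)\<close> with \<open>a, b \<ge> 1\<close>
  becomes \<open>u (a + b + 1)\<close>.
\<close>

definition hankel_block :: "nat \<Rightarrow> nat \<Rightarrow> 'a::field fps \<Rightarrow> 'a mat" where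
  "hankel_block n d f = mat n d (\<lambda>(a, b). fps_nth f (a + b + 1))"

definition stacked_hankel :: "nat \<Rightarrow> nat \<Rightarrow> nat \<Rightarrow> (nat \<Rightarrow> 'a::field fps) \<Rightarrow> 'a mat" where
  "stacked_hankel r n d \<alpha> =
     mat_of_rows d (concat (map (\<lambda>i. rows (hankel_block n d (\<alpha> i))) [1..<Suc r]))"

text \<open>For \<open>d = 0\<close> the following is \<open>{0}\<close>, since \<open>polys_below 0 = {0}\<close>.\<close>

definition Ker :: "nat \<Rightarrow> (nat \<Rightarrow> 'a::field fps) \<Rightarrow> nat \<Rightarrow> nat \<Rightarrow> 'a poly set" where
  "Ker r \<alpha> d n =
     {Q \<in> polys_below d. vec d (coeff Q) \<in> mat_kernel (stacked_hankel r n d \<alpha>)}"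

text \<open>
  The minimum is always attained: the matrix has \<open>r * n\<close> rows, so its kernel is nonzero
  for \<open>d = r * n + 1\<close>; see \<open>Ker_nontrivial\<close> below.
\<close>

definition L :: "nat \<Rightarrow> (nat \<Rightarrow> 'a::field fps) \<Rightarrow> nat \<Rightarrow> nat" where
  "L r \<alpha> n = (LEAST d. d \<ge> 1 \<and> Ker r \<alpha> d n \<noteq> {0})"

global_interpretation poly_vs: vector_space "Polynomial.smult :: 'a::field \<Rightarrow> 'a poly \<Rightarrow> 'a poly"
  by unfold_locales (simp_all add: smult_add_right smult_add_left)

lemma dim_row_stacked_hankel [simp]: "dim_row (stacked_hankel r n d \<alpha>) = r * n"
  by (simp add: stacked_hankel_def hankel_block_def length_concat comp_def sum_list_triv
        del: upt_Suc)

lemma dim_col_stacked_hankel [simp]: "dim_col (stacked_hankel r n d \<alpha>) = d"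
  unfolding stacked_hankel_def by (rule mat_of_rows_carrier(3))

lemma vec_coeff_add: "vec d (coeff (P + Q)) = vec d (coeff P) + vec d (coeff Q)"
  by (rule eq_vecI) simp_all

lemma vec_coeff_smult: "vec d (coeff (Polynomial.smult c Q)) = c \<cdot>\<^sub>v vec d (coeff Q)"
  by (rule eq_vecI) simp_all

lemma polys_below_iff: "Q \<in> polys_below d \<longleftrightarrow> (\<forall>i\<ge>d. coeff Q i = 0)"
proof
  assume "Q \<in> polys_below d"
  then show "\<forall>i\<ge>d. coeff Q i = 0"
    unfolding polys_below_def by (auto intro: coeff_eq_0)
next
  assume *: "\<forall>i\<ge>d. coeff Q i = 0"
  show "Q \<in> polys_below d"
  proof (cases "degree Q < d")
    case False
    then have "lead_coeff Q = 0"
      using * by simp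
    then show ?thesis
      unfolding polys_below_def by simp
  qed (simp add: polys_below_def)
qed

lemma Ker_iff:
  "Q \<in> Ker r \<alpha> d n \<longleftrightarrow>
     (\<forall>i\<ge>d. coeff Q i = 0) \<and> stacked_hankel r n d \<alpha> *\<^sub>v vec d (coeff Q) = 0\<^sub>v (r * n)"
  by (simp add: Ker_def polys_below_iff mat_kernel_def)

lemma subspace_Ker: "poly_vs.subspace (Ker r \<alpha> d n)"
proof (rule poly_vs.subspaceI)
  let ?A = "stacked_hankel r n d \<alpha>"
  have A: "?A \<in> carrier_mat (r * n) d"
    by (intro carrier_matI) simp_all
  have z: "vec d (coeff 0) = 0\<^sub>v d"
    by (rule eq_vecI) simp_all
  show "0 \<in> Ker r \<alpha> d n"
    unfolding Ker_iff z using A by (intro conjI eq_vecI) simp_all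
  show "P + Q \<in> Ker r \<alpha> d n" if "P \<in> Ker r \<alpha> d n" "Q \<in> Ker r \<alpha> d n" for P Q
    using that unfolding Ker_iff vec_coeff_add
    by (simp add: mult_add_distrib_mat_vec[OF A])
  show "Polynomial.smult c P \<in> Ker r \<alpha> d n" if "P \<in> Ker r \<alpha> d n" for c P
    using that unfolding Ker_iff vec_coeff_smult
    by (simp add: mult_mat_vec[OF A]) (rule eq_vecI; simp)
qed

lemma Ker_nontrivial:
  fixes \<alpha> :: "nat \<Rightarrow> 'a::field fps"
  shows "\<exists>d\<ge>1. Ker r \<alpha> d n \<noteq> {0}"
proof -
  define d where "d = r * n + 1"
  define A where "A = stacked_hankel r n d \<alpha>"
  define B where "B = mat d d (\<lambda>(i, j). if i < r * n then A $$ (i, j) else 0)"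
  have A: "A \<in> carrier_mat (r * n) d" and B: "B \<in> carrier_mat d d"
    unfolding A_def B_def by auto
  have "B = mat\<^sub>r d d (\<lambda>i. if i = r * n then 0\<^sub>v d else row B i)"
    by (rule eq_matI) (auto simp: B_def)
  then have "det B = 0"
    using det_row_0[of "r * n" d "row B"] B by (auto simp: d_def)
  then obtain v where v: "v \<in> carrier_vec d" "v \<noteq> 0\<^sub>v d" "B *\<^sub>v v = 0\<^sub>v d"
    using det_0_iff_vec_prod_zero_field[OF B] by auto
  have "A *\<^sub>v v = 0\<^sub>v (r * n)"
  proof (rule eq_vecI)
    fix i assume "i < dim_vec (0\<^sub>v (r * n) :: 'a vec)"
    then have i: "i < r * n" by simp
    then have "row A i = row B i"
      using A by (auto simp: B_def d_def)
    moreover have "(B *\<^sub>v v) $ i = 0"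
      using v(3) i by (simp add: d_def)
    ultimately show "(A *\<^sub>v v) $ i = 0\<^sub>v (r * n) $ i"
      using i A B by (simp add: d_def)
  qed (use A in simp)
  define Q where "Q = Poly (list_of_vec v)"
  have c: "vec d (coeff Q) = v"
    using v(1) by (intro eq_vecI) (auto simp: Q_def nth_default_def list_of_vec_index)
  have "coeff Q i = 0" if "i \<ge> d" for i
    using that v(1) by (simp add: Q_def nth_default_def)
  then have "Q \<in> Ker r \<alpha> d n"
    unfolding Ker_iff c using \<open>A *\<^sub>v v = 0\<^sub>v (r * n)\<close> by (simp add: A_def)
  moreover have "Q \<noteq> 0"
    using c v(2) by auto
  ultimately show ?thesis
    by (intro exI[of _ d]) (auto simp: d_def)
qed

end

theory Submission
  imports Defs
begin

text \<open>
  The point is the minimality of \<open>D\<close>. Membership in the kernel is a list of linear conditions on the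
  coefficients that does not see trailing zeros of the coefficient vector, so an element of
  \<open>Ker r \<alpha> D n\<close> whose coefficient at \<open>D - 1\<close> vanishes already belongs to \<open>Ker r \<alpha> (D - 1) n\<close>, which is
  trivial (lemmas \<open>Ker_drop_top\<close> and \<open>Ker_L_top_coeff\<close>). In other words the linear functional
  \<open>Q \<mapsto> coeff Q (D - 1)\<close> is injective on the nonzero space \<open>Ker r \<alpha> D n\<close>, and a nonzero space that embeds
  into the ground field is a line (lemma \<open>dim_eq_1_if_coeff_injective\<close>).
\<close>

lemma mat_of_rows_mult_eq_0_iff:
  assumes "set ws \<subseteq> carrier_vec d" and "v \<in> carrier_vec d"
  shows "mat_of_rows d ws *\<^sub>v v = 0\<^sub>v (length ws) \<longleftrightarrow> (\<forall>w\<in>set ws. w \<bullet> v = 0)"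
proof -
  have row: "row (mat_of_rows d ws) i = ws ! i" if "i < length ws" for i
    using that assms(1) nth_mem by (intro mat_of_rows_row) blast+
  have "mat_of_rows d ws *\<^sub>v v = 0\<^sub>v (length ws) \<longleftrightarrow> (\<forall>i<length ws. ws ! i \<bullet> v = 0)"
    by (simp add: vec_eq_iff row)
  then show ?thesis
    by (simp add: all_set_conv_all_nth)
qed

text \<open>
  Written with sums over coefficients, the kernel conditions for different values of \<open>d\<close> can be
  compared directly; the matrices themselves have different shapes.
\<close>

lemma Ker_iff_sum:
  "Q \<in> Ker r \<alpha> d n \<longleftrightarrow> (\<forall>b\<ge>d. coeff Q b = 0) \<and>
     (\<forall>i\<in>{1..r}. \<forall>a<n. (\<Sum>b<d. fps_nth (\<alpha> i) (a + b + 1) * coeff Q b) = 0)"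
proof -
  define ws where "ws = concat (map (\<lambda>i. rows (hankel_block n d (\<alpha> i))) [1..<Suc r])"
  have set_ws: "set ws = (\<Union>i\<in>{1..r}. set (rows (hankel_block n d (\<alpha> i))))"
    by (simp add: ws_def atLeastLessThanSuc_atLeastAtMost del: upt_Suc)
  have rows: "set (rows (hankel_block n d (\<alpha> i))) =
      (\<lambda>a. vec d (\<lambda>b. fps_nth (\<alpha> i) (a + b + 1))) ` {..<n}" for i
    by (auto simp: rows_def hankel_block_def)
  have stacked: "stacked_hankel r n d \<alpha> = mat_of_rows d ws"
    by (simp add: stacked_hankel_def ws_def)
  have len: "length ws = r * n"
    using dim_row_stacked_hankel[of r n d \<alpha>] by (simp add: stacked)
  have "set ws \<subseteq> carrier_vec d"
    unfolding set_ws rows by auto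
  from mat_of_rows_mult_eq_0_iff[OF this, of "vec d (coeff Q)"]
  show ?thesis
    unfolding Ker_iff stacked len set_ws rows
    by (simp add: scalar_prod_def atLeast0LessThan) blast
qed

lemma Ker_drop_top:
  assumes "Q \<in> Ker r \<alpha> (Suc d) n" and "coeff Q d = 0"
  shows "Q \<in> Ker r \<alpha> d n"
proof -
  have "coeff Q b = 0" if "b \<ge> d" for b
    using assms that by (cases "b = d") (simp_all add: Ker_iff_sum)
  then show ?thesis
    using assms by (simp add: Ker_iff_sum)
qed

lemma L_ge_1: "L r \<alpha> n \<ge> 1"
  and Ker_L_nontrivial: "Ker r \<alpha> (L r \<alpha> n) n \<noteq> {0}"
  using LeastI_ex[OF Ker_nontrivial[of r \<alpha> n]] by (simp_all add: L_def)

lemma Ker_below_L: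
  assumes "d < L r \<alpha> n"
  shows "Ker r \<alpha> d n = {0}"
proof (cases d)
  case 0
  then show ?thesis
    by (auto simp: Ker_iff_sum intro: poly_eqI)
next
  case (Suc e)
  then show ?thesis
    using not_less_Least[OF assms[unfolded L_def]] by simp
qed

lemma Ker_L_top_coeff:
  assumes "Q \<in> Ker r \<alpha> (L r \<alpha> n) n" and "coeff Q (L r \<alpha> n - 1) = 0"
  shows "Q = 0"
proof -
  have "Q \<in> Ker r \<alpha> (L r \<alpha> n - 1) n"
    using assms L_ge_1[of r \<alpha> n] by (cases "L r \<alpha> n") (simp_all add: Ker_drop_top)
  also have "\<dots> = {0}"
    using L_ge_1[of r \<alpha> n] by (intro Ker_below_L) simp
  finally show ?thesis by simp
qed

lemma dim_eq_1_if_coeff_injective: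
  fixes S :: "'a::field poly set"
  assumes S: "poly_vs.subspace S" and "S \<noteq> {0}"
    and inj: "\<And>Q. Q \<in> S \<Longrightarrow> coeff Q k = 0 \<Longrightarrow> Q = 0"
  shows "poly_vs.dim S = 1"
proof -
  obtain P where P: "P \<in> S" "P \<noteq> 0"
    using \<open>S \<noteq> {0}\<close> poly_vs.subspace_0[OF S] by blast
  have "Q \<in> poly_vs.span {P}" if "Q \<in> S" for Q
  proof -
    \<comment> \<open>the multiple of \<open>P\<close> with the same \<open>k\<close>-th coefficient as \<open>Q\<close>\<close>
    define c where "c = coeff Q k / coeff P k"
    have "coeff P k \<noteq> 0"
      using inj P by blast
    then have "coeff (Q - Polynomial.smult c P) k = 0"
      by (simp add: c_def)
    moreover have "Q - Polynomial.smult c P \<in> S"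
      using S P that by (intro poly_vs.subspace_diff poly_vs.subspace_scale)
    ultimately have "Q = Polynomial.smult c P"
      using inj by fastforce
    then show ?thesis
      by (simp add: poly_vs.span_base poly_vs.span_scale)
  qed
  then have "poly_vs.dim S = card {P}"
    using P by (intro poly_vs.dim_unique[of "{P}"]) auto
  then show ?thesis by simp
qed

theorem lemma3p2:
  fixes \<alpha> :: "nat \<Rightarrow> 'a::{field, finite} fps" and r n D :: nat
  assumes "r \<ge> 1"
    and "\<And>i. i \<in> {1..r} \<Longrightarrow> \<alpha> i \<in> frak_p"
    and "D = L r \<alpha> n"
  shows "poly_vs.dim (Ker r \<alpha> D n) = 1"
  unfolding assms(3)
  using subspace_Ker Ker_L_nontrivial Ker_L_top_coeff by (rule dim_eq_1_if_coeff_injective)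

end
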